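(* Let $f_1,\dots,f_m:\mathbb{R}^n\to\mathbb{R}$ and $g_1,\dots,g_l:\mathbb{R}^n\to\mathbb{R}$ be locally Lipschitz functions, and consider the problem (MOP) of minimizing $f=(f_1,\dots,f_m)$ over $X=\{x\in\mathbb{R}^n: g_r(x)\le 0,\ r=1,\dots,l\}$. Let $\{\varepsilon_k\}$ be a decreasing sequence of positive real numbers with $\varepsilon_k\to 0$ as $k\to\infty$. Let $\{x^k\}$ be a sequence of feasible points of MOP (i.e. $x^k\in X$ for all $k$) with $x^k\to x_0$ as $k\to\infty$. Assume that for each $k$, $x^k$ is a modified $\varepsilon_k$-KKT point of MOP, and that the Basic Constraint Qualification (BCQ) holds at $x_0$. Then $x_0$ is a KKT point of MOP.
   Context: Notation: $\|\cdot\|$ is the Euclidean norm, $\mathbb{R}^p_+$ is the nonnegative orthant, and $\partial^\circ h(x)$ is the Clarke subdifferential of a locally Lipschitz function $h:\mathbb{R}^n\to\mathbb{R}$ at $x$: $\partial^\circ h(x)=\{\xi\in\mathbb{R}^n: h^\circ(x,d)\ge\langle \xi,d\rangle\ \text{for all } d\in\mathbb{R}^n\}$, where $h^\circ(x,d)=\limsup_{y\to x,\,t\downarrow 0}\frac{h(y+td)-h(y)}{t}$. Modified $\varepsilon$-KKT point: for $\varepsilon\in\mathbb{R}_+$, a feasible point $\bar x\in X$ is a modified $\varepsilon$-KKT point of MOP if there exists $x_\varepsilon\in\mathbb{R}^n$ with $\|\bar x-x_\varepsilon\|\le\sqrt{\varepsilon}$, and there exist $u_i\in\partial^\circ f_i(x_\varepsilon)$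 for $i=1,\dots,m$, $v_r\in\partial^\circ g_r(x_\varepsilon)$ for $r=1,\dots,l$, $\lambda\in\mathbb{R}^m_+$ with $\|\lambda\|=1$ and $\mu\in\mathbb{R}^l_+$ such that $$\Big\|\sum_{i=1}^m\lambda_iu_i+\sum_{r=1}^l\mu_rv_r\Big\|\le\sqrt{\varepsilon}\quad\text{and}\quad \sum_{r=1}^l\mu_rg_r(\bar x)\ge-\varepsilon.$$ BCQ at $\bar x$: there exists no $p\in\mathbb{R}^l_+\setminus\{0\}$ such that $0\in\sum_{r=1}^l p_r\,\partial^\circ g_r(\bar x)$. KKT point: a feasible point $\bar x\in X$ is a KKT point of MOP if there exist $\lambda\in\mathbb{R}^m_+$ with $\|\lambda\|=1$, $\mu\in\mathbb{R}^l_+$, $u_i\in\partial^\circ f_i(\bar x)$ ($i=1,\dots,m$) and $v_r\in\partial^\circ g_r(\bar x)$ ($r=1,\dots,l$) such that $\sum_{i=1}^m\lambda_iu_i+\sum_{r=1}^l\mu_rv_r=0$ and $\sum_{r=1}^l\mu_rg_r(\bar x)=0$. *)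

theory Defs
  imports "HOL-Analysis.Analysis" "HOL-Library.Set_Algebras"
begin

text \<open>
  The problem MOP is given by families \<open>f :: 'm \<Rightarrow> real ^ 'n \<Rightarrow> real\<close> (objectives) and
  \<open>g :: 'l \<Rightarrow> real ^ 'n \<Rightarrow> real\<close> (constraints); \<open>CARD('n)\<close>, \<open>CARD('m)\<close> and \<open>CARD('l)\<close> are the
  dimensions n, m and l.
\<close>

definition locally_lipschitz :: "(real ^ 'n \<Rightarrow> real) \<Rightarrow> bool" where
  "locally_lipschitz h \<longleftrightarrow> (\<forall>x. \<exists>e>0. \<exists>L. L-lipschitz_on (ball x e) h)"

text \<open>
  The upper limit is taken in the extended reals, so that it exists for every \<open>h\<close>; it is finite
  when \<open>h\<close> is locally Lipschitz. As in Clarke's definition, \<open>y = x\<close> is allowed.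
\<close>

definition clarke_dd :: "(real ^ 'n \<Rightarrow> real) \<Rightarrow> real ^ 'n \<Rightarrow> real ^ 'n \<Rightarrow> ereal" where
  "clarke_dd h x d =
     Limsup (nhds x \<times>\<^sub>F at_right 0) (\<lambda>(y, t). ereal ((h (y + t *\<^sub>R d) - h y) / t))"

definition clarke_subdiff :: "(real ^ 'n \<Rightarrow> real) \<Rightarrow> real ^ 'n \<Rightarrow> (real ^ 'n) set" where
  "clarke_subdiff h x = {\<xi>. \<forall>d. clarke_dd h x d \<ge> ereal (\<xi> \<bullet> d)}"

definition feasible_set :: "('l \<Rightarrow> real ^ 'n \<Rightarrow> real) \<Rightarrow> (real ^ 'n) set" where
  "feasible_set g = {x. \<forall>r. g r x \<le> 0}"

definition nonneg_orthant :: "(real ^ 'p) set" where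
  "nonneg_orthant = {v. \<forall>i. 0 \<le> v $ i}"

definition modified_eps_KKT ::
  "('m::finite \<Rightarrow> real ^ 'n \<Rightarrow> real) \<Rightarrow> ('l::finite \<Rightarrow> real ^ 'n \<Rightarrow> real) \<Rightarrow> real \<Rightarrow> real ^ 'n \<Rightarrow> bool"
where
  "modified_eps_KKT f g \<epsilon> x \<longleftrightarrow>
     0 \<le> \<epsilon> \<and> x \<in> feasible_set g \<and>
     (\<exists>z. norm (x - z) \<le> sqrt \<epsilon> \<and>
       (\<exists>(u :: 'm \<Rightarrow> real ^ 'n) (v :: 'l \<Rightarrow> real ^ 'n) (lam :: real ^ 'm) (mu :: real ^ 'l).
          (\<forall>i. u i \<in> clarke_subdiff (f i) z) \<and>
          (\<forall>r. v r \<in> clarke_subdiff (g r) z) \<and>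
          lam \<in> nonneg_orthant \<and> norm lam = 1 \<and> mu \<in> nonneg_orthant \<and>
          norm ((\<Sum>i\<in>UNIV. lam $ i *\<^sub>R u i) + (\<Sum>r\<in>UNIV. mu $ r *\<^sub>R v r)) \<le> sqrt \<epsilon> \<and>
          (\<Sum>r\<in>UNIV. mu $ r * g r x) \<ge> - \<epsilon>))"

text \<open>The outer sum below is the Minkowski sum of sets.\<close>

definition BCQ :: "('l::finite \<Rightarrow> real ^ 'n \<Rightarrow> real) \<Rightarrow> real ^ 'n \<Rightarrow> bool" where
  "BCQ g x \<longleftrightarrow>
     \<not> (\<exists>p \<in> (nonneg_orthant :: (real ^ 'l) set) - {0}.
           0 \<in> (\<Sum>r\<in>UNIV. (\<lambda>\<xi>. p $ r *\<^sub>R \<xi>) ` clarke_subdiff (g r) x))"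

definition KKT_point ::
  "('m::finite \<Rightarrow> real ^ 'n \<Rightarrow> real) \<Rightarrow> ('l::finite \<Rightarrow> real ^ 'n \<Rightarrow> real) \<Rightarrow> real ^ 'n \<Rightarrow> bool"
where
  "KKT_point f g x \<longleftrightarrow>
     x \<in> feasible_set g \<and>
     (\<exists>(lam :: real ^ 'm) (mu :: real ^ 'l) (u :: 'm \<Rightarrow> real ^ 'n) (v :: 'l \<Rightarrow> real ^ 'n).
        lam \<in> nonneg_orthant \<and> norm lam = 1 \<and> mu \<in> nonneg_orthant \<and>
        (\<forall>i. u i \<in> clarke_subdiff (f i) x) \<and>
        (\<forall>r. v r \<in> clarke_subdiff (g r) x) \<and>
        (\<Sum>i\<in>UNIV. lam $ i *\<^sub>R u i) + (\<Sum>r\<in>UNIV. mu $ r *\<^sub>R v r) = 0 \<and>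
        (\<Sum>r\<in>UNIV. mu $ r * g r x) = 0)"

end

theory Submission
  imports Defs
begin

text \<open>
  The result is a compactness argument. Since each \<open>f i\<close> and \<open>g r\<close> is Lipschitz near \<open>x0\<close>, the
  subgradients appearing in the approximate conditions stay bounded
  (\<open>clarke_subgradient_norm_le\<close>), and the Clarke subdifferential has a closed graph
  (\<open>clarke_subdiff_closed_graph\<close>), so limits of these subgradients are subgradients at \<open>x0\<close>.

  The one quantity without an evident bound is the constraint multiplier \<open>mu k\<close>. Dividing the
  \<open>k\<close>-th condition by \<open>1 + norm (mu k)\<close> turns the pair of scale \<open>s k = 1 / (1 + norm (mu k))\<close> and
  multiplier \<open>nu k = s k *\<^sub>R mu k\<close> into one with \<open>s k + norm (nu k) = 1\<close>. A subsequence of all data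
  then converges, and the limit is a condition of Fritz John type:
  \<open>s (\<Sum>i. lam i u i) + (\<Sum>r. nu r v r) = 0\<close> with \<open>s + norm nu = 1\<close>. If \<open>s = 0\<close>, then \<open>nu\<close> is
  nonzero and contradicts the BCQ. So \<open>s > 0\<close>, and \<open>nu / s\<close> is the required KKT multiplier.
  Complementarity survives because the lower bound \<open>- \<epsilon> k\<close> tends to \<open>0\<close> while every term
  \<open>nu r * g r x0\<close> is nonpositive at the feasible point \<open>x0\<close>.
\<close>

section \<open>Clarke subgradients near a point\<close>

text \<open>
  If \<open>h\<close> has Lipschitz constant \<open>L\<close> near \<open>z\<close>, then all difference quotients in direction \<open>\<xi>\<close> are at
  most \<open>L * norm \<xi>\<close>; testing the subgradient inequality in the direction of the subgradient \<open>\<xi>\<close>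
  itself gives \<open>\<xi> \<bullet> \<xi> \<le> L * norm \<xi>\<close>.
\<close>

lemma clarke_subgradient_norm_le:
  fixes h :: "real ^ 'n \<Rightarrow> real"
  assumes lip: "L-lipschitz_on (ball x e) h" and z: "z \<in> ball x e"
    and \<xi>: "\<xi> \<in> clarke_subdiff h z"
  shows "norm \<xi> \<le> L"
proof -
  let ?F = "nhds z \<times>\<^sub>F at_right (0::real)"
  have fst_lim: "(fst \<longlongrightarrow> z) ?F"
    by (rule filterlim_fst)
  have snd_right: "filterlim snd (at_right 0) ?F"
    by (rule filterlim_snd)
  then have snd_lim: "(snd \<longlongrightarrow> 0) ?F"
    by (simp add: filterlim_at)
  have "((\<lambda>p. fst p + snd p *\<^sub>R \<xi>) \<longlongrightarrow> z + 0 *\<^sub>R \<xi>) ?F"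
    by (intro tendsto_intros fst_lim snd_lim)
  then have shifted_lim: "((\<lambda>p. fst p + snd p *\<^sub>R \<xi>) \<longlongrightarrow> z) ?F"
    by simp
  have "eventually (\<lambda>p. fst p \<in> ball x e) ?F"
    using fst_lim z by (rule topological_tendstoD[OF _ open_ball])
  moreover have "eventually (\<lambda>p. fst p + snd p *\<^sub>R \<xi> \<in> ball x e) ?F"
    using shifted_lim z by (rule topological_tendstoD[OF _ open_ball])
  moreover have "eventually (\<lambda>p. snd p > 0) ?F"
    using snd_right eventually_at_right_less[of "0::real"] by (auto simp: filterlim_iff)
  ultimately have "eventually (\<lambda>p. (case p of (y, t) \<Rightarrow> ereal ((h (y + t *\<^sub>R \<xi>) - h y) / t))
      \<le> ereal (L * norm \<xi>)) ?F"
  proof eventually_elim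
    case (elim p)
    obtain y t where p: "p = (y, t)"
      by fastforce
    have "dist (h (y + t *\<^sub>R \<xi>)) (h y) \<le> L * dist (y + t *\<^sub>R \<xi>) y"
      using elim p by (intro lipschitz_onD[OF lip]) auto
    then have "h (y + t *\<^sub>R \<xi>) - h y \<le> L * norm \<xi> * t"
      using elim p by (simp add: dist_norm mult_ac)
    then show ?case
      using elim p by (simp add: pos_divide_le_eq)
  qed
  then have "clarke_dd h z \<xi> \<le> ereal (L * norm \<xi>)"
    unfolding clarke_dd_def by (rule Limsup_bounded)
  moreover have "ereal (\<xi> \<bullet> \<xi>) \<le> clarke_dd h z \<xi>"
    using \<xi> by (auto simp: clarke_subdiff_def)
  ultimately have "ereal (\<xi> \<bullet> \<xi>) \<le> ereal (L * norm \<xi>)"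
    by (rule order_trans[rotated])
  then have "norm \<xi> * norm \<xi> \<le> L * norm \<xi>"
    by (simp add: power2_norm_eq_inner[symmetric] power2_eq_square)
  then show ?thesis
    using lipschitz_on_nonneg[OF lip] by (cases "\<xi> = 0") auto
qed

text \<open>
  The upper limit defining \<open>clarke_dd\<close> already ranges over all base points near \<open>x\<close>: a strict
  upper bound valid for difference quotients based near \<open>x\<close> also bounds those based near any \<open>z\<close>
  close to \<open>x\<close>. This is upper semicontinuity of \<open>clarke_dd h\<close> in the base point.
\<close>

lemma clarke_dd_upper_semicontinuous:
  fixes h :: "real ^ 'n \<Rightarrow> real"
  assumes "clarke_dd h x d < c"
  shows "eventually (\<lambda>z. clarke_dd h z d \<le> c) (nhds x)"
proof -
  have "eventually (\<lambda>p. (case p of (y, t) \<Rightarrow> ereal ((h (y + t *\<^sub>R d) - h y) / t)) < c)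
      (nhds x \<times>\<^sub>F at_right 0)"
    using assms unfolding clarke_dd_def by (rule Limsup_lessD)
  then obtain P Q where P: "eventually P (nhds x)" and Q: "eventually Q (at_right (0::real))"
    and PQ: "\<And>y t. P y \<Longrightarrow> Q t \<Longrightarrow> ereal ((h (y + t *\<^sub>R d) - h y) / t) < c"
    unfolding eventually_prod_filter by auto
  have "eventually (\<lambda>z. eventually P (nhds z)) (nhds x)"
    using P by (simp add: eventually_eventually)
  then show ?thesis
  proof eventually_elim
    case (elim z)
    have "eventually (\<lambda>p. (case p of (y, t) \<Rightarrow> ereal ((h (y + t *\<^sub>R d) - h y) / t)) \<le> c)
        (nhds z \<times>\<^sub>F at_right 0)"
      unfolding eventually_prod_filter using elim Q PQ
      by (intro exI[of _ P] exI[of _ Q]) (auto intro: less_imp_le)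
    then show ?case
      unfolding clarke_dd_def by (rule Limsup_bounded)
  qed
qed

text \<open>
  For a fixed direction \<open>d\<close>, upper semicontinuity bounds \<open>\<xi> k \<bullet> d\<close> eventually by any \<open>c\<close> above
  \<open>clarke_dd h x d\<close>, and this bound passes to the limit. The argument takes place in the extended
  reals, so it covers infinite directional derivatives as well.
\<close>

lemma clarke_subdiff_closed_graph:
  fixes h :: "real ^ 'n \<Rightarrow> real"
  assumes z: "z \<longlonglongrightarrow> x" and \<xi>: "\<xi> \<longlonglongrightarrow> \<xi>0"
    and sub: "\<And>k. \<xi> k \<in> clarke_subdiff h (z k)"
  shows "\<xi>0 \<in> clarke_subdiff h x"
proof -
  have "ereal (\<xi>0 \<bullet> d) \<le> clarke_dd h x d" for d
  proof (rule dense_ge)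
    fix c assume "clarke_dd h x d < c"
    then have "eventually (\<lambda>k. clarke_dd h (z k) d \<le> c) sequentially"
      using clarke_dd_upper_semicontinuous z unfolding filterlim_iff by blast
    then have "eventually (\<lambda>k. ereal (\<xi> k \<bullet> d) \<le> c) sequentially"
    proof eventually_elim
      case (elim k)
      then show ?case
        using sub[of k] by (auto simp: clarke_subdiff_def intro: order_trans)
    qed
    moreover have "(\<lambda>k. ereal (\<xi> k \<bullet> d)) \<longlonglongrightarrow> ereal (\<xi>0 \<bullet> d)"
      by (intro tendsto_intros \<xi>)
    ultimately show "ereal (\<xi>0 \<bullet> d) \<le> c"
      by (rule tendsto_upperbound[OF _ _ sequentially_bot, rotated])
  qed
  then show ?thesis
    by (simp add: clarke_subdiff_def)
qed

text \<open>
  Finite families of subgradients are collected into one vector with entries in \<open>real ^ 'n\<close>, so that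
  a single application of the Bolzano-Weierstrass theorem can extract limits of all of them.
\<close>

lemma bounded_clarke_subgradients:
  fixes h :: "'i::finite \<Rightarrow> real ^ 'n \<Rightarrow> real" and w :: "nat \<Rightarrow> 'i \<Rightarrow> real ^ 'n"
  assumes lip: "\<And>i. locally_lipschitz (h i)" and z: "z \<longlonglongrightarrow> x"
    and sub: "\<And>k i. w k i \<in> clarke_subdiff (h i) (z k)"
  shows "bounded (range (\<lambda>k. \<chi> i. w k i))"
proof -
  have "\<exists>L. eventually (\<lambda>k. norm (w k i) \<le> L) sequentially" for i
  proof -
    obtain e L where "e > 0" and L: "L-lipschitz_on (ball x e) (h i)"
      using lip[of i] unfolding locally_lipschitz_def by blast
    then have "eventually (\<lambda>k. z k \<in> ball x e) sequentially"
      by (intro topological_tendstoD[OF z]) auto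
    then have "eventually (\<lambda>k. norm (w k i) \<le> L) sequentially"
      by eventually_elim (rule clarke_subgradient_norm_le[OF L _ sub])
    then show ?thesis ..
  qed
  then obtain L where "eventually (\<lambda>k. norm (w k i) \<le> L i) sequentially" for i
    by metis
  then have "eventually (\<lambda>k. \<forall>i. norm (w k i) \<le> L i) sequentially"
    by (rule eventually_all_finite)
  then have "eventually (\<lambda>k. norm (\<chi> i. w k i) \<le> (\<Sum>i\<in>UNIV. L i)) sequentially"
  proof eventually_elim
    case (elim k)
    have "norm (\<chi> i. w k i) \<le> (\<Sum>i\<in>UNIV. norm (w k i))"
      by (subst norm_vec_def) (simp add: L2_set_le_sum)
    also have "\<dots> \<le> (\<Sum>i\<in>UNIV. L i)"
      using elim by (intro sum_mono) auto
    finally show ?case .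
  qed
  then show ?thesis
    by (metis BfunI Bseq_eq_bounded)
qed

section \<open>Multipliers\<close>

lemma nonneg_orthant_limit:
  fixes v :: "nat \<Rightarrow> real ^ 'p"
  assumes "v \<longlonglongrightarrow> v0" and "\<And>k. v k \<in> nonneg_orthant"
  shows "v0 \<in> nonneg_orthant"
proof -
  have "0 \<le> v0 $ i" for i
    using tendsto_vec_nth[OF assms(1), of i] assms(2)
    by (intro LIMSEQ_le_const[of "\<lambda>k. v k $ i"]) (auto simp: nonneg_orthant_def)
  then show ?thesis
    by (simp add: nonneg_orthant_def)
qed

lemma BCQ_D:
  fixes g :: "'l::finite \<Rightarrow> real ^ 'n \<Rightarrow> real" and p :: "real ^ 'l"
  assumes "BCQ g x" and "p \<in> nonneg_orthant" and "\<And>r. v r \<in> clarke_subdiff (g r) x"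
    and "(\<Sum>r\<in>UNIV. p $ r *\<^sub>R v r) = 0"
  shows "p = 0"
proof (rule ccontr)
  assume "p \<noteq> 0"
  have "(\<Sum>r\<in>UNIV. p $ r *\<^sub>R v r) \<in> (\<Sum>r\<in>UNIV. (\<lambda>\<xi>. p $ r *\<^sub>R \<xi>) ` clarke_subdiff (g r) x)"
    using assms(3) by (auto simp: set_sum_alt)
  with assms(1,2,4) \<open>p \<noteq> 0\<close> show False
    unfolding BCQ_def by auto
qed

section \<open>Limits of modified KKT points\<close>

theorem theorem3p4:
  fixes f :: "'m::finite \<Rightarrow> real ^ 'n::finite \<Rightarrow> real"
    and g :: "'l::finite \<Rightarrow> real ^ 'n \<Rightarrow> real"
    and \<epsilon> :: "nat \<Rightarrow> real"
    and x :: "nat \<Rightarrow> real ^ 'n"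
    and x0 :: "real ^ 'n"
  assumes "\<And>i. locally_lipschitz (f i)"
    and "\<And>r. locally_lipschitz (g r)"
    and "\<And>k. \<epsilon> k > 0"
    and "decseq \<epsilon>"
    and "\<epsilon> \<longlonglongrightarrow> 0"
    and "\<And>k. x k \<in> feasible_set g"
    and "x \<longlonglongrightarrow> x0"
    and "\<And>k. modified_eps_KKT f g (\<epsilon> k) (x k)"
    and "BCQ g x0"
  shows "KKT_point f g x0"
proof -
  define approx where "approx k z u v lam mu \<longleftrightarrow> norm (x k - z) \<le> sqrt (\<epsilon> k) \<and>
      (\<forall>i. u i \<in> clarke_subdiff (f i) z) \<and> (\<forall>r. v r \<in> clarke_subdiff (g r) z) \<and>
      lam \<in> nonneg_orthant \<and> norm lam = 1 \<and> mu \<in> nonneg_orthant \<and>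
      norm ((\<Sum>i\<in>UNIV. lam $ i *\<^sub>R u i) + (\<Sum>r\<in>UNIV. mu $ r *\<^sub>R v r)) \<le> sqrt (\<epsilon> k) \<and>
      (\<Sum>r\<in>UNIV. mu $ r * g r (x k)) \<ge> - \<epsilon> k" for k z u v lam mu
  have "\<forall>k. \<exists>z u v lam mu. approx k z u v lam mu"
    using assms(8) unfolding modified_eps_KKT_def approx_def by blast
  then obtain z u v lam mu where "\<And>k. approx k (z k) (u k) (v k) (lam k) (mu k)"
    by metis
  then have near: "norm (x k - z k) \<le> sqrt (\<epsilon> k)"
    and u: "u k i \<in> clarke_subdiff (f i) (z k)"
    and v: "v k r \<in> clarke_subdiff (g r) (z k)"
    and lam: "lam k \<in> nonneg_orthant" "norm (lam k) = 1"
    and mu: "mu k \<in> nonneg_orthant"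
    and stat: "norm ((\<Sum>i\<in>UNIV. lam k $ i *\<^sub>R u k i) + (\<Sum>r\<in>UNIV. mu k $ r *\<^sub>R v k r))
      \<le> sqrt (\<epsilon> k)"
    and compl: "(\<Sum>r\<in>UNIV. mu k $ r * g r (x k)) \<ge> - \<epsilon> k" for k i r
    unfolding approx_def by blast+
  have sqrt_lim: "(\<lambda>k. sqrt (\<epsilon> k)) \<longlonglongrightarrow> 0"
    using tendsto_real_sqrt[OF assms(5)] by simp
  have "(\<lambda>k. x k - z k) \<longlonglongrightarrow> 0"
    using near by (intro Lim_null_comparison[OF _ sqrt_lim]) auto
  from tendsto_diff[OF assms(7) this] have z: "z \<longlonglongrightarrow> x0"
    by simp

  \<comment> \<open>The factor \<open>s k\<close> is chosen so that \<open>s k\<close> and \<open>nu k\<close> are bounded but cannot both tend to \<open>0\<close>.\<close>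
  define s where "s k = 1 / (1 + norm (mu k))" for k
  define nu where "nu k = s k *\<^sub>R mu k" for k
  have s01: "0 < s k" "s k \<le> 1" for k
    by (auto simp: s_def add_pos_nonneg)
  have s_nu: "s k + norm (nu k) = 1" for k
  proof -
    have "norm (nu k) = norm (mu k) / (1 + norm (mu k))"
      unfolding nu_def s_def by (simp add: abs_of_nonneg)
    then show ?thesis
      unfolding s_def by (simp add: add_divide_distrib[symmetric] add_nonneg_eq_0_iff)
  qed
  have nu: "nu k \<in> nonneg_orthant" for k
    using mu[of k] s01(1)[of k] by (auto simp: nu_def nonneg_orthant_def)
  have stat': "norm (s k *\<^sub>R (\<Sum>i\<in>UNIV. lam k $ i *\<^sub>R u k i) + (\<Sum>r\<in>UNIV. nu k $ r *\<^sub>R v k r))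
      \<le> sqrt (\<epsilon> k)" for k
  proof -
    have "s k *\<^sub>R (\<Sum>i\<in>UNIV. lam k $ i *\<^sub>R u k i) + (\<Sum>r\<in>UNIV. nu k $ r *\<^sub>R v k r)
        = s k *\<^sub>R ((\<Sum>i\<in>UNIV. lam k $ i *\<^sub>R u k i) + (\<Sum>r\<in>UNIV. mu k $ r *\<^sub>R v k r))"
      by (simp add: nu_def scaleR_add_right scaleR_sum_right)
    then show ?thesis
      using mult_mono[OF s01(2)[of k] stat[of k]] s01(1)[of k] by simp
  qed
  have compl': "(\<Sum>r\<in>UNIV. nu k $ r * g r (x k)) \<ge> - \<epsilon> k" for k
  proof -
    have "s k * \<epsilon> k \<le> \<epsilon> k"
      using s01[of k] assms(3)[of k] by (simp add: mult_le_cancel_right1)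
    then have "- \<epsilon> k \<le> s k * (- \<epsilon> k)"
      by simp
    also have "\<dots> \<le> s k * (\<Sum>r\<in>UNIV. mu k $ r * g r (x k))"
      using compl[of k] s01(1)[of k] by (intro mult_left_mono) auto
    also have "\<dots> = (\<Sum>r\<in>UNIV. nu k $ r * g r (x k))"
      by (simp add: nu_def sum_distrib_left mult_ac)
    finally show ?thesis .
  qed

  \<comment> \<open>Gathering all data in one product space yields a common convergent subsequence.\<close>
  define T where "T k = ((\<chi> i. u k i), (\<chi> r. v k r), lam k, nu k, s k)" for k
  have "range T \<subseteq> range (\<lambda>k. \<chi> i. u k i) \<times> range (\<lambda>k. \<chi> r. v k r) \<times>
      cball 0 1 \<times> cball 0 1 \<times> cball 0 1"
  proof -
    have "norm (nu k) \<le> 1" for k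
      using s_nu[of k] s01(1)[of k] by linarith
    moreover have "\<bar>s k\<bar> \<le> 1" for k
      using s01[of k] by simp
    ultimately show ?thesis
      using lam(2) by (auto simp: T_def)
  qed
  moreover have "bounded (range (\<lambda>k. \<chi> i. u k i) \<times> range (\<lambda>k. \<chi> r. v k r) \<times>
      cball (0 :: real ^ 'm) 1 \<times> cball (0 :: real ^ 'l) 1 \<times> cball (0 :: real) 1)"
    using bounded_clarke_subgradients[OF assms(1) z u]
      bounded_clarke_subgradients[OF assms(2) z v]
    by (intro bounded_Times bounded_cball)
  ultimately have "bounded (range T)"
    by (rule bounded_subset[rotated])
  then obtain T0 \<rho> where \<rho>: "strict_mono (\<rho> :: nat \<Rightarrow> nat)" and T0: "(T \<circ> \<rho>) \<longlonglongrightarrow> T0"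
    using bounded_imp_convergent_subsequence by blast
  obtain U V lam0 nu0 s0 where T0_eq: "T0 = (U, V, lam0, nu0, s0)"
    by (cases T0) auto
  have lims: "(\<lambda>k. \<chi> i. u (\<rho> k) i) \<longlonglongrightarrow> U" "(\<lambda>k. \<chi> r. v (\<rho> k) r) \<longlonglongrightarrow> V"
    "(\<lambda>k. lam (\<rho> k)) \<longlonglongrightarrow> lam0" "(\<lambda>k. nu (\<rho> k)) \<longlonglongrightarrow> nu0" "(\<lambda>k. s (\<rho> k)) \<longlonglongrightarrow> s0"
    using tendsto_fst[OF T0] tendsto_fst[OF tendsto_snd[OF T0]]
      tendsto_fst[OF tendsto_snd[OF tendsto_snd[OF T0]]]
      tendsto_fst[OF tendsto_snd[OF tendsto_snd[OF tendsto_snd[OF T0]]]]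
      tendsto_snd[OF tendsto_snd[OF tendsto_snd[OF tendsto_snd[OF T0]]]]
    by (simp_all add: T0_eq T_def o_def)
  have u_lim: "(\<lambda>k. u (\<rho> k) i) \<longlonglongrightarrow> U $ i" for i
    using tendsto_vec_nth[OF lims(1), of i] by simp
  have v_lim: "(\<lambda>k. v (\<rho> k) r) \<longlonglongrightarrow> V $ r" for r
    using tendsto_vec_nth[OF lims(2), of r] by simp
  have z_lim: "(\<lambda>k. z (\<rho> k)) \<longlonglongrightarrow> x0" and x_lim: "(\<lambda>k. x (\<rho> k)) \<longlonglongrightarrow> x0"
    and \<epsilon>_lim: "(\<lambda>k. \<epsilon> (\<rho> k)) \<longlonglongrightarrow> 0" and sqrt_lim': "(\<lambda>k. sqrt (\<epsilon> (\<rho> k))) \<longlonglongrightarrow> 0"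
    using LIMSEQ_subseq_LIMSEQ[OF z \<rho>] LIMSEQ_subseq_LIMSEQ[OF assms(7) \<rho>]
      LIMSEQ_subseq_LIMSEQ[OF assms(5) \<rho>] LIMSEQ_subseq_LIMSEQ[OF sqrt_lim \<rho>]
    by (simp_all add: o_def)
  have g_lim: "(\<lambda>k. g r (x (\<rho> k))) \<longlonglongrightarrow> g r x0" for r
  proof -
    obtain e L where "e > 0" "L-lipschitz_on (ball x0 e) (g r)"
      using assms(2)[of r] unfolding locally_lipschitz_def by blast
    then have "continuous (at x0) (g r)"
      using lipschitz_on_continuous_on continuous_on_interior by fastforce
    then show ?thesis
      using x_lim by (rule isCont_tendsto_compose)
  qed

  have U: "U $ i \<in> clarke_subdiff (f i) x0" for i
    using z_lim u_lim u by (rule clarke_subdiff_closed_graph)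
  have V: "V $ r \<in> clarke_subdiff (g r) x0" for r
    using z_lim v_lim v by (rule clarke_subdiff_closed_graph)
  have lam0: "lam0 \<in> nonneg_orthant" and nu0: "nu0 \<in> nonneg_orthant"
    using lims(3,4) lam(1) nu by (auto intro: nonneg_orthant_limit)
  have norm_lam0: "norm lam0 = 1"
    using tendsto_norm[OF lims(3)] lam(2) by (simp add: LIMSEQ_const_iff)
  have "(\<lambda>k. s (\<rho> k) + norm (nu (\<rho> k))) \<longlonglongrightarrow> s0 + norm nu0"
    by (intro tendsto_intros lims)
  then have s_nu0: "s0 + norm nu0 = 1"
    by (simp add: s_nu LIMSEQ_const_iff)
  have "0 \<le> s0"
    using s01(1) by (intro LIMSEQ_le_const[OF lims(5)]) (auto intro: less_imp_le)
  have feas: "x0 \<in> feasible_set g"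
  proof -
    have "g r x0 \<le> 0" for r
      using assms(6) by (intro LIMSEQ_le_const2[OF g_lim]) (auto simp: feasible_set_def)
    then show ?thesis
      by (simp add: feasible_set_def)
  qed
  have "(\<lambda>k. s (\<rho> k) *\<^sub>R (\<Sum>i\<in>UNIV. lam (\<rho> k) $ i *\<^sub>R u (\<rho> k) i) + (\<Sum>r\<in>UNIV. nu (\<rho> k) $ r *\<^sub>R v (\<rho> k) r))
      \<longlonglongrightarrow> s0 *\<^sub>R (\<Sum>i\<in>UNIV. lam0 $ i *\<^sub>R U $ i) + (\<Sum>r\<in>UNIV. nu0 $ r *\<^sub>R V $ r)"
    by (intro tendsto_intros lims u_lim v_lim)
  moreover have "(\<lambda>k. s (\<rho> k) *\<^sub>R (\<Sum>i\<in>UNIV. lam (\<rho> k) $ i *\<^sub>R u (\<rho> k) i) + (\<Sum>r\<in>UNIV. nu (\<rho> k) $ r *\<^sub>R v (\<rho> k) r))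
      \<longlonglongrightarrow> 0"
    using stat' by (intro Lim_null_comparison[OF _ sqrt_lim']) auto
  ultimately have fritz_john:
    "s0 *\<^sub>R (\<Sum>i\<in>UNIV. lam0 $ i *\<^sub>R U $ i) + (\<Sum>r\<in>UNIV. nu0 $ r *\<^sub>R V $ r) = 0"
    by (rule LIMSEQ_unique)
  have "(\<lambda>k. \<Sum>r\<in>UNIV. nu (\<rho> k) $ r * g r (x (\<rho> k))) \<longlonglongrightarrow> (\<Sum>r\<in>UNIV. nu0 $ r * g r x0)"
    by (intro tendsto_intros lims g_lim)
  from LIMSEQ_le[OF tendsto_minus[OF \<epsilon>_lim] this] compl'
  have "0 \<le> (\<Sum>r\<in>UNIV. nu0 $ r * g r x0)"
    by simp
  moreover have "(\<Sum>r\<in>UNIV. nu0 $ r * g r x0) \<le> 0"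
    using nu0 feas by (intro sum_nonpos mult_nonneg_nonpos) (auto simp: nonneg_orthant_def feasible_set_def)
  ultimately have compl0: "(\<Sum>r\<in>UNIV. nu0 $ r * g r x0) = 0"
    by simp

  \<comment> \<open>If \<open>s0\<close> were \<open>0\<close>, the objectives would drop out of the limiting condition.\<close>
  have "s0 \<noteq> 0"
  proof
    assume "s0 = 0"
    with fritz_john have "nu0 = 0"
      by (intro BCQ_D[OF assms(9) nu0 V]) simp
    with \<open>s0 = 0\<close> s_nu0 show False
      by simp
  qed
  with \<open>0 \<le> s0\<close> have "s0 > 0"
    by simp
  \<comment> \<open>Undo the scaling in the limit.\<close>
  define mu0 where "mu0 = inverse s0 *\<^sub>R nu0"
  have "mu0 \<in> nonneg_orthant"
    using nu0 \<open>s0 > 0\<close> by (simp add: mu0_def nonneg_orthant_def)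
  moreover have "(\<Sum>i\<in>UNIV. lam0 $ i *\<^sub>R U $ i) + (\<Sum>r\<in>UNIV. mu0 $ r *\<^sub>R V $ r) = 0"
  proof -
    have "(\<Sum>i\<in>UNIV. lam0 $ i *\<^sub>R U $ i) + (\<Sum>r\<in>UNIV. mu0 $ r *\<^sub>R V $ r) = inverse s0 *\<^sub>R
        (s0 *\<^sub>R (\<Sum>i\<in>UNIV. lam0 $ i *\<^sub>R U $ i) + (\<Sum>r\<in>UNIV. nu0 $ r *\<^sub>R V $ r))"
      using \<open>s0 > 0\<close> by (simp add: mu0_def scaleR_add_right scaleR_sum_right mult.assoc[symmetric])
    then show ?thesis
      by (simp add: fritz_john)
  qed
  moreover have "(\<Sum>r\<in>UNIV. mu0 $ r * g r x0) = 0"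
  proof -
    have "(\<Sum>r\<in>UNIV. mu0 $ r * g r x0) = inverse s0 * (\<Sum>r\<in>UNIV. nu0 $ r * g r x0)"
      by (simp add: mu0_def sum_distrib_left mult_ac)
    then show ?thesis
      by (simp add: compl0)
  qed
  ultimately show ?thesis
    unfolding KKT_point_def using feas lam0 norm_lam0 U V by blast
qed

end
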